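(* Let $n\geq 2$, let $W$ be the Coxeter group of type $A_n$ and let $\mathbf{W}$ be its flipping group. For each $0\leq i\leq \lfloor\frac{n+1}{2}\rfloor$, the set $$O_i=\{a\in F_2^n : wt(a)=i \text{ or } wt(a)=n+1-i\}$$ is an orbit of $F_2^n$ under the action of $\mathbf{W}$.
   Context: The Coxeter graph of type $A_n$ has vertex set $S=\{s_1,\dots,s_n\}$ and edge set $R=\{s_is_{i+1} : 1\le i\le n-1\}$ (a path). The Coxeter group $W$ of type $A_n$ is generated by $S$ with relations $s^2=1$, $(ss')^3=1$ if $ss'\in R$, and $(ss')^2=1$ if $s\ne s'$, $ss'\notin R$. $F_2^n$ is the space of column vectors over the two-element field $F_2$ indexed by $S$, and $\widetilde{s}$ is the characteristic vector of $s\in S$. For $s\in S$, $\mathbf{s}$ is the $n\times n$ matrix over $F_2$ acting by $\mathbf{s}\widetilde{v}=\widetilde{v}$ for $v\ne s$ and $\mathbf{s}\widetilde{s}=\widetilde{s}+\sum_{us\in R}\widetilde{u}$. The flipping group $\mathbf{W}$ is the subgroup of $\mathrm{GL}_n(F_2)$ generated by $\mathbf{s}$, $s\in S$; it acts on $F_2^n$ by left multiplication. Put $\overline{1}=\widetilde{s}_1$ and $\overline{i+1}=\mathbf{s_i}\mathbf{s_{i-1}}\cdots\mathbf{s_1}\overline{1}$ for $1\le i\le n$; thus $\overline{i}=\widetilde{s}_{i-1}+\widetilde{s}_i$ for $2\le i\le n$ and $\overline{n+1}=\widetilde{s}_n$. The set $\Delta=\{\overline{1},\dots,\overline{n}\}$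 is a basis of $F_2^n$. For $a\in F_2^n$, $wt(a)$ is the number of elements of $\Delta$ appearing in the expression of $a$ as a linear combination of elements of $\Delta$. *)

theory Defs
  imports
    "Jordan_Normal_Form.VS_Connect"
    "HOL-Algebra.Generated_Groups"
    "HOL-Algebra.Group_Action"
    "HOL-Library.Z2"
begin

text \<open>
  \<open>F\<^sub>2\<close> is the type \<^typ>\<open>bit\<close>. Indices start at 0, as in the matrix library:
  the vertices are \<open>0, \<dots>, n - 1\<close>, where \<open>i\<close> stands for \<open>s\<^bsub>i+1\<^esub>\<close>, and the
  characteristic vector of \<open>v\<close> is \<^term>\<open>unit_vec n v\<close>.
\<close>

definition path_edges :: "nat \<Rightarrow> nat set set" where
  "path_edges n = {{i, Suc i} | i. Suc i < n}"

text \<open>The columns of a matrix are the images of the characteristic vectors.\<close>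

definition flip_mat :: "nat \<Rightarrow> nat set set \<Rightarrow> nat \<Rightarrow> bit mat" where
  "flip_mat n R s = mat_of_cols n
     (map (\<lambda>v. if v = s
               then unit_vec n s + finsum_vec TYPE(bit) n (unit_vec n) {u. u < n \<and> {u, s} \<in> R}
               else unit_vec n v)
          [0..<n])"

abbreviation GL2 :: "nat \<Rightarrow> bit mat monoid" where
  "GL2 n \<equiv> units_of (ring_mat TYPE(bit) n ())"

definition flipping_group :: "nat \<Rightarrow> nat set set \<Rightarrow> bit mat monoid" where
  "flipping_group n R = (GL2 n)\<lparr>carrier := generate (GL2 n) (flip_mat n R ` {..<n})\<rparr>"

text \<open>
  Left multiplication, restricted to the space of column vectors because permutations
  of a set are extensional functions in \<^term>\<open>BijGroup\<close>.
\<close>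

definition mult_action :: "nat \<Rightarrow> bit mat \<Rightarrow> bit vec \<Rightarrow> bit vec" where
  "mult_action n A = (\<lambda>x \<in> carrier_vec n. A *\<^sub>v x)"

text \<open>\<open>bar_vec n i\<close> is the vector written \<open>i+1\<close> with an overline.\<close>

fun bar_vec :: "nat \<Rightarrow> nat \<Rightarrow> bit vec" where
  "bar_vec n 0 = unit_vec n 0"
| "bar_vec n (Suc i) = flip_mat n (path_edges n) i *\<^sub>v bar_vec n i"

definition Delta :: "nat \<Rightarrow> bit vec set" where
  "Delta n = bar_vec n ` {..<n}"

text \<open>
  The coefficient function is unique, since \<^term>\<open>Delta n\<close> is a basis; its values
  outside the basis are fixed by extensionality.
\<close>

definition Delta_coeffs :: "nat \<Rightarrow> bit vec \<Rightarrow> bit vec \<Rightarrow> bit" where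
  "Delta_coeffs n a = (THE c. c \<in> extensional (Delta n) \<and>
     module.lincomb (module_vec TYPE(bit) n) c (Delta n) = a)"

definition wt :: "nat \<Rightarrow> bit vec \<Rightarrow> nat" where
  "wt n a = card {d \<in> Delta n. Delta_coeffs n a d \<noteq> 0}"

end

theory Submission
  imports Defs
begin

text \<open>
  A subset \<open>A\<close> of \<open>{0, \<dots>, n}\<close> has an edge cut in the path on \<open>{0, \<dots>, n}\<close>, a vector in
  \<open>F\<^sub>2\<^sup>n\<close>. Every vector is a cut, and it determines \<open>A\<close> up to complement. The \<open>i\<close>-th generator
  of the flipping group acts on cuts by the transposition of \<open>i\<close> and \<open>i + 1\<close> on \<open>A\<close>, and
  \<^term>\<open>bar_vec n i\<close> is the cut of \<open>{i}\<close>, so the weight of the cut of \<open>A\<close> is \<open>card A\<close> if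
  \<open>n \<notin> A\<close>. Hence \<open>O\<^sub>i\<close> is the set of cuts of \<open>i\<close>-element sets, and the adjacent transpositions
  act transitively on these.
\<close>

section \<open>Cuts of vertex sets in the path on \<open>n + 1\<close> vertices\<close>

definition cut_vec :: "nat \<Rightarrow> nat set \<Rightarrow> bit vec" where
  "cut_vec n A = vec n (\<lambda>j. of_bool ((j \<in> A) \<noteq> (Suc j \<in> A)))"

abbreviation swap_adj :: "nat \<Rightarrow> nat \<Rightarrow> nat" where
  "swap_adj s \<equiv> Transposition.transpose s (Suc s)"

lemma cut_vec_carrier [simp]: "cut_vec n A \<in> carrier_vec n"
  by (simp add: cut_vec_def)

lemma index_cut_vec: "j < n \<Longrightarrow> cut_vec n A $ j = of_bool ((j \<in> A) \<noteq> (Suc j \<in> A))"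
  by (simp add: cut_vec_def)

lemma cut_vec_complement:
  assumes "A \<subseteq> {..n}"
  shows "cut_vec n ({..n} - A) = cut_vec n A"
  by (rule eq_vecI) (auto simp: cut_vec_def)

text \<open>Leaving out \<open>n\<close> selects one set from each complementary pair. Starting at
  \<open>n\<close>, where both memberships fail, coordinate \<open>j\<close> passes agreement from
  \<open>Suc j\<close> down to \<open>j\<close>.\<close>

lemma cut_vec_inj:
  assumes A: "A \<subseteq> {..<n}" and B: "B \<subseteq> {..<n}" and eq: "cut_vec n A = cut_vec n B"
  shows "A = B"
proof -
  have "j \<in> A \<longleftrightarrow> j \<in> B" if "j \<le> n" for j
    using that
  proof (induction rule: inc_induct)
    case base
    then show ?case using A B by auto
  next
    case (step j)
    have "cut_vec n A $ j = cut_vec n B $ j" by (simp add: eq)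
    with step show ?case by (auto simp: index_cut_vec split: if_splits)
  qed
  with A B show ?thesis by fastforce
qed

lemma cut_vec_surj:
  assumes a: "a \<in> carrier_vec n"
  obtains A where "A \<subseteq> {..<n}" "a = cut_vec n A"
proof -
  \<comment> \<open>As \<open>n\<close> is to lie outside \<open>A\<close>, a vertex
    \<open>j\<close> belongs to \<open>A\<close> exactly if an odd number of edges between
    \<open>j\<close> and \<open>n\<close> are cut.\<close>
  define A where "A = {j. j < n \<and> (\<Sum>k\<in>{j..<n}. a $ k) = 1}"
  have "a = cut_vec n A"
  proof (rule eq_vecI)
    fix j assume "j < dim_vec (cut_vec n A)"
    then have j: "j < n" by (simp add: cut_vec_def)
    then have "(\<Sum>k\<in>{j..<n}. a $ k) = a $ j + (\<Sum>k\<in>{Suc j..<n}. a $ k)"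
      by (rule sum.atLeast_Suc_lessThan)
    \<comment> \<open>At \<open>Suc j = n\<close> the sum is empty, hence 0, in accordance with
      \<open>n\<close> lying outside \<open>A\<close>.\<close>
    moreover have "Suc j \<in> A \<longleftrightarrow> (\<Sum>k\<in>{Suc j..<n}. a $ k) = 1"
      by (cases "Suc j < n") (auto simp: A_def)
    ultimately show "a $ j = cut_vec n A $ j"
      using j by (cases "a $ j"; cases "\<Sum>k\<in>{Suc j..<n}. a $ k") (simp_all add: index_cut_vec A_def)
  qed (use a in \<open>simp add: cut_vec_def\<close>)
  moreover have "A \<subseteq> {..<n}" by (auto simp: A_def)
  ultimately show thesis using that by blast
qed

section \<open>The generators as adjacent transpositions\<close>

lemma flip_mat_carrier [simp]: "flip_mat n R s \<in> carrier_mat n n"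
  by (simp add: flip_mat_def mat_of_cols_def)

lemma index_flip_mat_path:
  assumes "j < n" "k < n" "s < n"
  shows "flip_mat n (path_edges n) s $$ (j, k) =
    of_bool (j = k \<or> k = s \<and> (j = Suc s \<or> s = Suc j))"
proof -
  let ?U = "{u. u < n \<and> {u, s} \<in> path_edges n}"
  have U: "u \<in> ?U \<longleftrightarrow> u < n \<and> (u = Suc s \<or> s = Suc u)" for u
    using assms by (auto simp: path_edges_def doubleton_eq_iff)
  have "finsum_vec TYPE(bit) n (unit_vec n) ?U $ j = (\<Sum>u\<in>?U. unit_vec n u $ j)"
    using assms by (intro index_finsum_vec) auto
  also have "\<dots> = (\<Sum>u\<in>?U. if u = j then 1 else 0)"
    using assms by (intro sum.cong) auto
  also have "\<dots> = of_bool (j \<in> ?U)"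
    by (simp add: sum.delta')
  finally have sum: "finsum_vec TYPE(bit) n (unit_vec n) ?U $ j = of_bool (j = Suc s \<or> s = Suc j)"
    using assms by (simp only: U simp_thms)
  have "finsum_vec TYPE(bit) n (unit_vec n) ?U \<in> carrier_vec n"
    by (rule finsum_vec_closed) auto
  then show ?thesis
    using assms sum by (auto simp: flip_mat_def mat_of_cols_index)
qed

text \<open>Swapping the ends of edge \<open>s\<close> does not change whether that edge is cut. The
  status of a neighbouring edge changes exactly if the two ends lie on different sides, that is, if
  coordinate \<open>s\<close> is 1; the matrix adds this coordinate to its neighbours.\<close>

lemma flip_mat_mult_cut_vec:
  assumes s: "s < n"
  shows "flip_mat n (path_edges n) s *\<^sub>v cut_vec n A = cut_vec n (swap_adj s ` A)"
proof (rule eq_vecI)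
  fix j assume "j < dim_vec (cut_vec n (swap_adj s ` A))"
  then have j: "j < n" by (simp add: cut_vec_def)
  let ?M = "flip_mat n (path_edges n) s"
  have mem: "x \<in> swap_adj s ` A \<longleftrightarrow> swap_adj s x \<in> A" for x
    by (metis image_iff transpose_involutory)
  have "(?M *\<^sub>v cut_vec n A) $ j = (\<Sum>k\<in>{0..<n}. ?M $$ (j, k) * cut_vec n A $ k)"
    using j carrier_matD[OF flip_mat_carrier[of n "path_edges n" s]]
    by (simp add: scalar_prod_def cut_vec_def)
  also have "\<dots> = (\<Sum>k\<in>{0..<n}. (if k = j then cut_vec n A $ k else 0) +
      (if k = s then of_bool (j = Suc s \<or> s = Suc j) * cut_vec n A $ k else 0))"
    using j s by (intro sum.cong) (auto simp: index_flip_mat_path)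
  also have "\<dots> = cut_vec n A $ j + of_bool (j = Suc s \<or> s = Suc j) * cut_vec n A $ s"
    using j s by (simp only: sum.distrib sum.delta finite_atLeastLessThan atLeastLessThan_iff) simp
  also have "\<dots> = cut_vec n (swap_adj s ` A) $ j"
    using j s by (auto simp: index_cut_vec mem Transposition.transpose_def)
  finally show "(?M *\<^sub>v cut_vec n A) $ j = cut_vec n (swap_adj s ` A) $ j" .
qed (use carrier_matD[OF flip_mat_carrier[of n "path_edges n" s]] in \<open>simp add: cut_vec_def\<close>)

lemma swap_adj_image_subset:
  assumes "s < n" "A \<subseteq> {..n}"
  shows "swap_adj s ` A \<subseteq> {..n}"
  using assms by (auto simp: Transposition.transpose_def)

lemma card_swap_adj_image: "card (swap_adj s ` A) = card A"
  by (rule card_image) (rule inj_on_transpose)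

text \<open>Every unit vector is a cut, and a transposition applied twice restores the underlying
  set.\<close>

lemma flip_mat_square:
  assumes s: "s < n"
  shows "flip_mat n (path_edges n) s * flip_mat n (path_edges n) s = 1\<^sub>m n" (is "?M * ?M = _")
proof (rule mat_col_eqI)
  fix k assume "k < dim_col (1\<^sub>m n :: bit mat)"
  then have k: "k < n" by simp
  obtain A where A: "unit_vec n k = cut_vec n A"
    using cut_vec_surj[of "unit_vec n k" n] by auto
  have M: "?M \<in> carrier_mat n n" by simp
  have "col (?M * ?M) k = ?M *\<^sub>v (?M *\<^sub>v unit_vec n k)"
    using k M by (metis col_mult2 col_one one_carrier_mat right_mult_one_mat)
  also have "\<dots> = cut_vec n (swap_adj s ` swap_adj s ` A)"
    by (simp add: A flip_mat_mult_cut_vec[OF s])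
  also have "swap_adj s ` swap_adj s ` A = A"
    by (simp add: image_image)
  finally show "col (?M * ?M) k = col (1\<^sub>m n) k"
    using A k by simp
qed (use carrier_matD[OF flip_mat_carrier[of n "path_edges n" s]] in auto)

section \<open>The flipping group and its action on cuts\<close>

lemma mat_monoid: "monoid (ring_mat TYPE(bit) n ())"
  by (rule ring.is_monoid[OF ring_mat])

lemma
  assumes s: "s < n"
  shows flip_mat_in_GL2: "flip_mat n (path_edges n) s \<in> carrier (GL2 n)"
    and inv_flip_mat: "inv\<^bsub>GL2 n\<^esub> flip_mat n (path_edges n) s = flip_mat n (path_edges n) s"
proof -
  let ?M = "flip_mat n (path_edges n) s"
  have sq: "?M \<otimes>\<^bsub>ring_mat TYPE(bit) n ()\<^esub> ?M = \<one>\<^bsub>ring_mat TYPE(bit) n ()\<^esub>"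
    using flip_mat_square[OF s] by (simp add: ring_mat_simps)
  then show M: "?M \<in> carrier (GL2 n)"
    by (auto simp: units_of_def Units_def ring_mat_simps)
  interpret G: group "GL2 n"
    by (rule monoid.units_group[OF mat_monoid])
  show "inv\<^bsub>GL2 n\<^esub> ?M = ?M"
    using sq M by (intro G.inv_equality) (simp_all add: units_of_def)
qed

lemma GL2_simps:
  "A \<otimes>\<^bsub>GL2 n\<^esub> B = A * B" "\<one>\<^bsub>GL2 n\<^esub> = 1\<^sub>m n"
  "A \<in> carrier (GL2 n) \<Longrightarrow> A \<in> carrier_mat n n"
  by (auto simp: units_of_def ring_mat_simps Units_def)

lemma flipping_group_path_closed:
  assumes "g \<in> carrier (flipping_group n (path_edges n))"
  shows "g \<in> carrier_mat n n"
proof -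
  interpret G: group "GL2 n"
    by (rule monoid.units_group[OF mat_monoid])
  have "flip_mat n (path_edges n) ` {..<n} \<subseteq> carrier (GL2 n)"
    using flip_mat_in_GL2 by blast
  then have "g \<in> carrier (GL2 n)"
    using assms G.generate_incl by (auto simp: flipping_group_def)
  then show ?thesis by (rule GL2_simps(3))
qed

text \<open>Transpositions preserve cardinality, and this passes to products; inverses add nothing,
  since the generators are involutions. The sets range over subsets of \<open>{..n}\<close> because
  the last transposition can move \<open>n\<close> into a set.\<close>

lemma flipping_group_cut_vec:
  assumes "g \<in> carrier (flipping_group n (path_edges n))" "A \<subseteq> {..n}"
  obtains B where "B \<subseteq> {..n}" "card B = card A" "g *\<^sub>v cut_vec n A = cut_vec n B"
proof -
  let ?S = "flip_mat n (path_edges n) ` {..<n}"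
  have flip: "\<exists>B. B \<subseteq> {..n} \<and> card B = card A \<and> flip_mat n (path_edges n) s *\<^sub>v cut_vec n A = cut_vec n B"
    if "s < n" "A \<subseteq> {..n}" for s A
    using that flip_mat_mult_cut_vec swap_adj_image_subset card_swap_adj_image
    by (intro exI[of _ "swap_adj s ` A"]) simp
  have "g \<in> generate (GL2 n) ?S"
    using assms(1) by (simp add: flipping_group_def)
  then have "\<exists>B. B \<subseteq> {..n} \<and> card B = card A \<and> g *\<^sub>v cut_vec n A = cut_vec n B"
    using assms(2)
  \<comment> \<open>\<open>A\<close> is generalised because in a product the left factor acts on the
    cut of a new set.\<close>
  proof (induction arbitrary: A rule: generate.induct)
    case one
    then show ?case by (auto simp: GL2_simps)
  next
    case (incl h)
    then show ?case using flip by auto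
  next
    case (inv h)
    then show ?case using flip by (auto simp: inv_flip_mat)
  next
    case (eng h1 h2)
    then obtain B where B: "B \<subseteq> {..n}" "card B = card A" "h2 *\<^sub>v cut_vec n A = cut_vec n B"
      by meson
    with eng.IH(1) obtain C where C: "C \<subseteq> {..n}" "card C = card B" "h1 *\<^sub>v cut_vec n B = cut_vec n C"
      by meson
    have "h1 \<in> carrier_mat n n" "h2 \<in> carrier_mat n n"
      using eng.hyps flipping_group_path_closed by (auto simp: flipping_group_def)
    then have "(h1 * h2) *\<^sub>v cut_vec n A = h1 *\<^sub>v (h2 *\<^sub>v cut_vec n A)"
      by (simp add: assoc_mult_mat_vec[of _ n n _ n])
    then have "(h1 \<otimes>\<^bsub>GL2 n\<^esub> h2) *\<^sub>v cut_vec n A = cut_vec n C"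
      by (simp add: GL2_simps B C)
    with B C show ?case by auto
  qed
  with that show thesis by blast
qed

text \<open>A set other than an initial segment has a descent \<open>Suc k \<in> A\<close>, \<open>k \<notin> A\<close>; swapping there lowers its sum.\<close>

lemma initial_segment_cut_vec_transitive:
  assumes "A \<subseteq> {..n}"
  obtains g where "g \<in> carrier (flipping_group n (path_edges n))"
    "g *\<^sub>v cut_vec n {..<card A} = cut_vec n A"
proof -
  have "\<exists>g \<in> carrier (flipping_group n (path_edges n)). g *\<^sub>v cut_vec n {..<card A} = cut_vec n A"
    using assms
  proof (induction "\<Sum>A" arbitrary: A rule: less_induct)
    case less
    have fin: "finite A" using less.prems finite_subset by blast
    show ?case
    proof (cases "\<exists>k. Suc k \<in> A \<and> k \<notin> A")
      case True
      then obtain k where k: "Suc k \<in> A" "k \<notin> A" by blast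
      then have kn: "k < n" using less.prems by auto
      have img: "swap_adj k ` A = insert k (A - {Suc k})"
        using k by (auto simp: Transposition.transpose_def image_iff split: if_splits)
      have "\<Sum>(swap_adj k ` A) = k + \<Sum>(A - {Suc k})"
        unfolding img using k fin by (subst sum.insert) auto
      moreover have "\<Sum>A = Suc k + \<Sum>(A - {Suc k})"
        using k fin by (simp add: sum.remove)
      ultimately have "\<Sum>(swap_adj k ` A) < \<Sum>A" by simp
      then obtain g where g: "g \<in> carrier (flipping_group n (path_edges n))"
        and gA: "g *\<^sub>v cut_vec n {..<card A} = cut_vec n (swap_adj k ` A)"
        using less.hyps[of "swap_adj k ` A"] swap_adj_image_subset[OF kn less.prems]
        by (auto simp: card_swap_adj_image)
      let ?M = "flip_mat n (path_edges n) k"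
      \<comment> \<open>The transposition is an involution, so applying it after \<open>g\<close>
        leads from the swapped set back to \<open>A\<close>.\<close>
      have "?M \<otimes>\<^bsub>GL2 n\<^esub> g \<in> carrier (flipping_group n (path_edges n))"
        using g kn by (auto simp: flipping_group_def intro: generate.eng generate.incl)
      moreover have "(?M * g) *\<^sub>v cut_vec n {..<card A} = ?M *\<^sub>v (g *\<^sub>v cut_vec n {..<card A})"
        using flipping_group_path_closed[OF g] by (simp add: assoc_mult_mat_vec[of _ n n _ n])
      then have "(?M * g) *\<^sub>v cut_vec n {..<card A} = cut_vec n A"
        by (simp add: gA flip_mat_mult_cut_vec[OF kn] image_image)
      ultimately show ?thesis by (auto simp: GL2_simps)
    next
      case False
      \<comment> \<open>Without a descent, \<open>A\<close> is closed downwards and thus an initial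
        segment, for which the identity matrix serves.\<close>
      have down: "j \<in> A" if "j \<le> k" "k \<in> A" for j k
        using that by (induction rule: inc_induct) (use False in auto)
      have "A = {..<card A}"
      proof (cases "A = {}")
        case False
        then have "A = {..Max A}"
          using fin down by (auto intro: Max_in)
        then show ?thesis by (metis card_atMost lessThan_Suc_atMost)
      qed simp
      then have "1\<^sub>m n *\<^sub>v cut_vec n {..<card A} = cut_vec n A" by simp
      moreover have "1\<^sub>m n \<in> carrier (flipping_group n (path_edges n))"
        using generate.one[of "GL2 n"] by (simp add: flipping_group_def GL2_simps)
      ultimately show ?thesis by blast
    qed
  qed
  with that show thesis by blast
qed

section \<open>The basis \<open>Delta n\<close> and the weight\<close>

lemma bar_vec_eq_cut_vec:
  assumes "i \<le> n" "0 < n"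
  shows "bar_vec n i = cut_vec n {i}"
  using assms(1)
proof (induction i)
  case 0
  show ?case
    by (rule eq_vecI) (auto simp: cut_vec_def unit_vec_def)
next
  case (Suc i)
  \<comment> \<open>The transposition of \<open>i\<close> and \<open>Suc i\<close> carries
    \<open>{i}\<close> to \<open>{Suc i}\<close>.\<close>
  then show ?case by (simp add: flip_mat_mult_cut_vec)
qed

lemma inj_on_bar_vec: "inj_on (bar_vec n) {..<n}"
proof (rule inj_onI)
  fix i j assume "i \<in> {..<n}" "j \<in> {..<n}" "bar_vec n i = bar_vec n j"
  then show "i = j"
    using cut_vec_inj[of "{i}" n "{j}"] bar_vec_eq_cut_vec[of i n] bar_vec_eq_cut_vec[of j n] by auto
qed

text \<open>Over the two-element field, the sum of two cuts is the cut of the symmetric difference,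
  so adding the cuts of singletons yields the cut of the support of \<open>c\<close>.\<close>

lemma lincomb_Delta:
  "module.lincomb (module_vec TYPE(bit) n) c (Delta n) = cut_vec n {i. i < n \<and> c (bar_vec n i) \<noteq> 0}"
  (is "?l = cut_vec n ?A")
proof (rule eq_vecI)
  interpret vec_space "TYPE(bit)" n .
  have Delta: "Delta n \<subseteq> carrier_vec n" "finite (Delta n)"
    by (auto simp: Delta_def bar_vec_eq_cut_vec)
  show "dim_vec ?l = dim_vec (cut_vec n ?A)"
    using lincomb_dim[OF Delta(2,1)] by (simp add: cut_vec_def)
  fix j assume "j < dim_vec (cut_vec n ?A)"
  then have j: "j < n" by (simp add: cut_vec_def)
  let ?c = "\<lambda>i. c (bar_vec n i)"
  have "?l $ j = (\<Sum>x\<in>Delta n. c x * x $ j)"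
    by (rule lincomb_index[OF j Delta(1)])
  also have "\<dots> = (\<Sum>i<n. ?c i * bar_vec n i $ j)"
    by (simp add: Delta_def sum.reindex[OF inj_on_bar_vec])
  also have "\<dots> = (\<Sum>i<n. (if i = j then ?c i else 0) + (if i = Suc j then ?c i else 0))"
    using j by (intro sum.cong) (auto simp: bar_vec_eq_cut_vec index_cut_vec simp del: bar_vec.simps)
  \<comment> \<open>For \<open>j = n - 1\<close> the second term vanishes:
    \<open>bar_vec n n\<close> is not among the vectors indexed by \<open>{..<n}\<close>.\<close>
  also have "\<dots> = ?c j + (if Suc j < n then ?c (Suc j) else 0)"
    using j by (simp only: sum.distrib sum.delta finite_lessThan lessThan_iff) (simp del: bar_vec.simps)
  also have "\<dots> = cut_vec n ?A $ j"
    using j by (cases "?c j"; cases "?c (Suc j)") (simp_all add: index_cut_vec del: bar_vec.simps)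
  finally show "?l $ j = cut_vec n ?A $ j" .
qed

text \<open>By \<open>cut_vec_inj\<close> the vector determines the support of its coefficients, and
  a function with values in \<open>bit\<close> is determined by its support. This uniqueness lets
  the definite description in \<open>Delta_coeffs\<close> be evaluated.\<close>

lemma wt_cut_vec:
  assumes A: "A \<subseteq> {..<n}"
  shows "wt n (cut_vec n A) = card A"
proof -
  define c where "c = (\<lambda>x\<in>Delta n. of_bool (x \<in> bar_vec n ` A) :: bit)"
  have cA: "{i. i < n \<and> c (bar_vec n i) \<noteq> 0} = A"
    using A inj_on_bar_vec[of n] by (auto simp: c_def Delta_def inj_on_def)
  have "Delta_coeffs n (cut_vec n A) = c"
    unfolding Delta_coeffs_def
  proof (rule the_equality)
    show "c \<in> extensional (Delta n) \<and>
        module.lincomb (module_vec TYPE(bit) n) c (Delta n) = cut_vec n A"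
      by (simp only: lincomb_Delta cA) (simp add: c_def)
  next
    fix d assume d: "d \<in> extensional (Delta n) \<and>
        module.lincomb (module_vec TYPE(bit) n) d (Delta n) = cut_vec n A"
    then have "{i. i < n \<and> d (bar_vec n i) \<noteq> 0} = A"
      using A by (intro cut_vec_inj[of _ n]) (auto simp: lincomb_Delta)
    with cA have eq: "d (bar_vec n i) \<noteq> 0 \<longleftrightarrow> c (bar_vec n i) \<noteq> 0" if "i < n" for i
      using that by blast
    show "d = c"
    proof (rule extensionalityI)
      fix x assume "x \<in> Delta n"
      then have "d x \<noteq> 0 \<longleftrightarrow> c x \<noteq> 0"
        using eq by (auto simp only: Delta_def)
      then show "d x = c x"
        by (cases "d x"; cases "c x") simp_all
    qed (use d in \<open>auto simp: c_def\<close>)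
  qed
  moreover have "{d \<in> Delta n. c d \<noteq> 0} = bar_vec n ` A"
    using A by (auto simp: c_def Delta_def)
  ultimately show ?thesis
    using A by (simp add: wt_def card_image inj_on_subset[OF inj_on_bar_vec])
qed

text \<open>A vector is the cut of two complementary sets, and its weight is the size of the one
  avoiding \<open>n\<close>. The two admissible weights therefore record whether the set of size
  \<open>i\<close> avoids or contains \<open>n\<close>.\<close>

lemma weight_class_eq_cuts:
  assumes "i \<le> Suc n"
  shows "{a \<in> carrier_vec n. wt n a = i \<or> wt n a = n + 1 - i} =
    cut_vec n ` {A. A \<subseteq> {..n} \<and> card A = i}" (is "?O = ?C")
proof
  have compl: "card ({..n} - A) = n + 1 - card A" if "A \<subseteq> {..n}" for A
    using that by (simp add: card_Diff_subset finite_subset)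
  show "?O \<subseteq> ?C"
  proof
    fix a assume a: "a \<in> ?O"
    then obtain A where A: "A \<subseteq> {..<n}" "a = cut_vec n A"
      using cut_vec_surj by blast
    then have A': "A \<subseteq> {..n}" by auto
    from a A consider "card A = i" | "card A = n + 1 - i"
      by (auto simp: wt_cut_vec)
    then show "a \<in> ?C"
    proof cases
      case 1
      with A A' show ?thesis by blast
    next
      case 2
      \<comment> \<open>The bound on \<open>i\<close> keeps the truncated subtraction
        \<open>n + 1 - (n + 1 - i)\<close> equal to \<open>i\<close>.\<close>
      then have "card ({..n} - A) = i" using compl[OF A'] assms by simp
      then show ?thesis
        using A(2) cut_vec_complement[OF A'] by (intro image_eqI[of _ _ "{..n} - A"]) auto
    qed
  qed
  show "?C \<subseteq> ?O"
  proof
    fix a assume "a \<in> ?C"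
    then obtain A where A: "A \<subseteq> {..n}" "card A = i" "a = cut_vec n A" by blast
    show "a \<in> ?O"
    proof (cases "n \<in> A")
      case True
      then have "{..n} - A \<subseteq> {..<n}" by (auto simp: le_less)
      then have "wt n a = card ({..n} - A)"
        using wt_cut_vec cut_vec_complement[OF A(1)] A(3) by metis
      then show ?thesis using A compl by simp
    next
      case False
      with A(1) have "A \<subseteq> {..<n}" by (auto simp: subset_iff le_less)
      then show ?thesis using A by (simp add: wt_cut_vec)
    qed
  qed
qed

theorem proposition5p5:
  fixes n i :: nat
  assumes "n \<ge> 2" and "i \<le> (n + 1) div 2"
  shows "{a \<in> carrier_vec n. wt n a = i \<or> wt n a = n + 1 - i}
    \<in> orbits (flipping_group n (path_edges n)) (carrier_vec n) (mult_action n)"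
proof -
  let ?G = "flipping_group n (path_edges n)"
  have i: "i \<le> Suc n" using assms by simp
  \<comment> \<open>The initial segment of size \<open>i\<close> is the base point: invariance of
    cardinality bounds its orbit from above, and transitivity fills it.\<close>
  have "orbit ?G (mult_action n) (cut_vec n {..<i}) = cut_vec n ` {A. A \<subseteq> {..n} \<and> card A = i}"
  proof
    show "orbit ?G (mult_action n) (cut_vec n {..<i}) \<subseteq> cut_vec n ` {A. A \<subseteq> {..n} \<and> card A = i}"
    proof
      fix a assume "a \<in> orbit ?G (mult_action n) (cut_vec n {..<i})"
      then obtain g where g: "g \<in> carrier ?G" "a = g *\<^sub>v cut_vec n {..<i}"
        by (auto simp: orbit_def mult_action_def)
      moreover have "{..<i} \<subseteq> {..n}" using i by auto
      ultimately obtain B where "B \<subseteq> {..n}" "card B = card {..<i}" "a = cut_vec n B"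
        using flipping_group_cut_vec by metis
      then show "a \<in> cut_vec n ` {A. A \<subseteq> {..n} \<and> card A = i}" by auto
    qed
    show "cut_vec n ` {A. A \<subseteq> {..n} \<and> card A = i} \<subseteq> orbit ?G (mult_action n) (cut_vec n {..<i})"
    proof clarify
      fix A assume "A \<subseteq> {..n}" "i = card A"
      then show "cut_vec n A \<in> orbit ?G (mult_action n) (cut_vec n {..<card A})"
        using initial_segment_cut_vec_transitive[of A n]
        by (force simp: orbit_def mult_action_def)
    qed
  qed
  then show ?thesis
    unfolding weight_class_eq_cuts[OF i] orbits_def by (auto intro: exI[of _ "cut_vec n {..<i}"])
qed

end
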